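(* Let $\boldsymbol d$ be a Wadge degree with $\boldsymbol d\subseteq\boldsymbol{\Pi}^0_3$ and $\boldsymbol d\neq\{\emptyset\},\{2^\omega\}$. Then $\mathscr W_{\boldsymbol d}=\{[A]\in\mathrm{MALG}:\Phi(A)\in\boldsymbol d\}$ is topologically dense in $\mathrm{MALG}$: for every measurable $A$ and every $\varepsilon>0$ there is a measurable $B$ with $\mu(A\triangle B)<\varepsilon$ and $\Phi(B)\in\boldsymbol d$. Moreover $B$ can be chosen so that $\Phi(B)=\Phi(U)=\Phi(C)$ for some open $U$ and some closed $C$.
   Context: $2^\omega$ is the Cantor space; $N_s=\{x:s\subset x\}$; $\mu$ the coin-tossing measure, $\mu(N_s)=2^{-\mathrm{lh}(s)}$. $\Phi(A)=\{x:\lim_n\mu(A\cap N_{x\restriction n})/\mu(N_{x\restriction n})=1\}$ for measurable $A$. $\mathrm{MALG}$ is the measure algebra (measurable sets modulo null sets) with metric $\delta([A],[B])=\mu(A\triangle B)$. For $X,Y\subseteq2^\omega$, $X\le_W Y$ iff $X=f^{-1}(Y)$ for some continuous $f:2^\omega\to2^\omega$; $X\equiv_W Y$ iff both $X\le_W Y$ and $Y\le_W X$; a Wadge degree is an $\equiv_W$-equivalence class. $\boldsymbol{\Pi}^0_3$ is the class of $F_{\sigma\delta}$ sets. *)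

theory Defs
  imports "HOL-Probability.Probability"
begin

type_synonym cantor = "nat \<Rightarrow> bool"

definition nbhd :: "bool list \<Rightarrow> cantor set" where
  "nbhd s = {x. \<forall>i < length s. x i = s ! i}"

definition restr :: "cantor \<Rightarrow> nat \<Rightarrow> bool list" where
  "restr x n = map x [0..<n]"

definition cantor_open :: "cantor set \<Rightarrow> bool" where
  "cantor_open U \<longleftrightarrow> (\<forall>x\<in>U. \<exists>n. nbhd (restr x n) \<subseteq> U)"

definition cantor_closed :: "cantor set \<Rightarrow> bool" where
  "cantor_closed C \<longleftrightarrow> cantor_open (- C)"

definition cantor_continuous :: "(cantor \<Rightarrow> cantor) \<Rightarrow> bool" where
  "cantor_continuous f \<longleftrightarrow>
     (\<forall>U. cantor_open U \<longrightarrow> cantor_open (f -` U))"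

definition Pi03 :: "cantor set \<Rightarrow> bool" where
  "Pi03 X \<longleftrightarrow> (\<exists>F :: nat \<Rightarrow> nat \<Rightarrow> cantor set.
     (\<forall>i j. cantor_closed (F i j)) \<and> X = (\<Inter>i. \<Union>j. F i j))"

definition wadge_le :: "cantor set \<Rightarrow> cantor set \<Rightarrow> bool" where
  "wadge_le X Y \<longleftrightarrow> (\<exists>f. cantor_continuous f \<and> X = f -` Y)"

definition wadge_eq :: "cantor set \<Rightarrow> cantor set \<Rightarrow> bool" where
  "wadge_eq X Y \<longleftrightarrow> wadge_le X Y \<and> wadge_le Y X"

definition wadge_degree :: "cantor set set \<Rightarrow> bool" where
  "wadge_degree d \<longleftrightarrow> (\<exists>X. d = {Y. wadge_eq Y X})"

text \<open>Coin-tossing measure (completed, so "measurable" = mu-measurable).\<close>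
definition coin :: "cantor measure" where
  "coin = completion (Pi\<^sub>M UNIV (\<lambda>_. measure_pmf (bernoulli_pmf (1/2))))"

definition Phi :: "cantor set \<Rightarrow> cantor set" where
  "Phi A = {x. (\<lambda>n. measure coin (A \<inter> nbhd (restr x n)) / measure coin (nbhd (restr x n)))
               \<longlonglongrightarrow> 1}"

definition symdiff :: "'a set \<Rightarrow> 'a set \<Rightarrow> 'a set" where
  "symdiff A B = (A - B) \<union> (B - A)"

end

theory Submission
  imports Defs
begin

text \<open>
  Let \<open>X\<close> be in the given degree. Since \<open>X\<close> is \<open>F\<^sub>\<sigma>\<^sub>\<delta>\<close>, there is a rank \<open>a x n\<close>, depending only on
  the first \<open>n\<close> bits of \<open>x\<close>, with \<open>x \<in> X\<close> iff \<open>a x n\<close> tends to infinity. Embed the Cantor space as the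
  closed null set (the spine) of sequences whose odd bits vanish. A point off the spine leaves it at
  some stage \<open>n\<close>, together with a whole cylinder; let \<open>W\<close> be the set of all \<open>x\<close> extending the
  first \<open>n div 2\<close> even bits. On this cylinder let \<open>B\<close> be everything if \<open>W \<subseteq> X\<close>, nothing if \<open>W\<close>
  misses \<open>X\<close>, and otherwise a clopen set of relative measure \<open>1 - 2^(-a)\<close> with \<open>a\<close> the rank of the
  prefix. Then the density of \<open>B\<close> at the code of \<open>x\<close> is 1 iff \<open>x \<in> X\<close>.
  Conversely \<open>Phi B\<close> reduces to \<open>X\<close>: decode on the spine, and off the spine pick a point of \<open>W\<close>
  inside or outside \<open>X\<close>, which exists by the choice of \<open>B\<close>. As \<open>B\<close> is clopen off the null spine,
  \<open>B\<close> is open and its union with the spine is closed. Finally, leaving the spine at an early stage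
  imposes nothing, so there \<open>B\<close> may be a clopen approximation of \<open>A\<close>; late stages have small measure.
\<close>

section \<open>Cylinders, open sets and continuity on the Cantor space\<close>

definition cyl :: "cantor \<Rightarrow> nat \<Rightarrow> cantor set" where
  "cyl x n = {y. \<forall>i<n. y i = x i}"

lemma nbhd_restr: "nbhd (restr x n) = cyl x n"
  by (simp add: nbhd_def restr_def cyl_def)

lemma cyl_self [simp]: "x \<in> cyl x n"
  by (simp add: cyl_def)

lemma cyl_eqI: "y \<in> cyl x n \<Longrightarrow> cyl y n = cyl x n"
  by (auto simp: cyl_def)

lemma cyl_antimono: "m \<le> n \<Longrightarrow> cyl x n \<subseteq> cyl x m"
  by (auto simp: cyl_def)

lemma cantor_open_iff: "cantor_open U \<longleftrightarrow> (\<forall>x\<in>U. \<exists>n. cyl x n \<subseteq> U)"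
  by (simp add: cantor_open_def nbhd_restr)

lemma cantor_continuousI:
  assumes "\<And>x n. \<exists>m. \<forall>y\<in>cyl x m. f y \<in> cyl (f x) n"
  shows "cantor_continuous f"
  unfolding cantor_continuous_def cantor_open_iff
  using assms by (metis (no_types, lifting) subsetD subsetI vimageE vimageI2)

lemma wadge_le_refl: "wadge_le X X"
  unfolding wadge_le_def by (rule exI[of _ "\<lambda>x. x"]) (auto simp: cantor_continuous_def)

section \<open>Ranks for F-sigma-delta sets\<close>

lemma closed_cyl_disjoint:
  assumes "cantor_closed F" "x \<notin> F"
  shows "\<exists>n. cyl x n \<inter> F = {}"
  using assms unfolding cantor_closed_def cantor_open_iff by blast

text \<open>Follow, for each \<open>i\<close>, the least \<open>j\<close> for which \<open>F i j\<close> still meets the current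
  cylinder: it stabilizes iff \<open>x \<in> (\<Union>j. F i j)\<close>.
  The rank is the least \<open>i\<close> whose guess has just changed.\<close>

lemma Pi03_rank:
  assumes "Pi03 X"
  shows "\<exists>a :: cantor \<Rightarrow> nat \<Rightarrow> nat. (\<forall>x n. \<forall>y\<in>cyl x n. a y n = a x n) \<and>
           (\<forall>x. x \<in> X \<longleftrightarrow> (\<forall>k. \<exists>N. \<forall>n\<ge>N. k \<le> a x n))"
proof -
  obtain F :: "nat \<Rightarrow> nat \<Rightarrow> cantor set"
    where F: "\<And>i j. cantor_closed (F i j)" and X: "X = (\<Inter>i. \<Union>j. F i j)"
    using assms unfolding Pi03_def by blast
  \<comment> \<open>The disjunct \<open>n \<le> j\<close> keeps the minimum defined when no
    \<open>F i j\<close> meets the cylinder, and drives the guess to infinity when \<open>x\<close>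
    lies in no \<open>F i j\<close>.\<close>
  define g where "g i x n = (LEAST j. n \<le> j \<or> cyl x n \<inter> F i j \<noteq> {})" for i n :: nat and x
  define a where "a x n = (LEAST i. n \<le> i \<or> g i x n \<noteq> g i x (n - 1))" for x and n :: nat
  have g_local: "g i y m = g i x m" if "y \<in> cyl x n" "m \<le> n" for x y i m n
  proof -
    have "y \<in> cyl x m" using that cyl_antimono by blast
    then show ?thesis by (simp add: g_def cyl_eqI)
  qed
  have a_local: "a y n = a x n" if "y \<in> cyl x n" for x y n
    unfolding a_def using g_local[OF that, of n] g_local[OF that, of "n - 1"] by simp
  have g_prop: "n \<le> g i x n \<or> cyl x n \<inter> F i (g i x n) \<noteq> {}" for i x n
    unfolding g_def by (rule LeastI[of _ n]) simp
  have g_mono: "g i x m \<le> g i x n" if "m \<le> n" for i x m n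
  proof -
    have "m \<le> g i x n \<or> cyl x m \<inter> F i (g i x n) \<noteq> {}"
      using g_prop[of n i x] cyl_antimono[OF that, of x] that by auto
    then show ?thesis unfolding g_def[of i x m] by (rule Least_le)
  qed
  have stab: "\<exists>N. \<forall>n\<ge>N. g i x n = g i x (n - 1)" if x: "x \<in> (\<Union>j. F i j)" for i x
  proof -
    obtain j where "x \<in> F i j" using x by blast
    then have bnd: "g i x n \<le> j" for n
      unfolding g_def by (intro Least_le) (auto intro: cyl_self)
    then have fin: "finite (range (g i x))"
      using finite_subset[of "range (g i x)" "{..j}"] by auto
    have "Max (range (g i x)) \<in> range (g i x)" using fin by (intro Max_in) auto
    then obtain N where N: "Max (range (g i x)) = g i x N" by (rule rangeE)
    have "g i x n = g i x N" if "n \<ge> N" for n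
      using g_mono[OF that, of i x] N Max_ge[OF fin, of "g i x n"] by auto
    then have "\<forall>n\<ge>Suc N. g i x n = g i x (n - 1)"
      by (metis Suc_le_D diff_Suc_1 le_SucI not_less_eq_eq)
    then show ?thesis by blast
  qed
  have unst: "x \<in> (\<Union>j. F i j)" if st: "\<forall>n\<ge>N. g i x n = g i x (n - 1)" for i x N
  proof (rule ccontr)
    assume nx: "x \<notin> (\<Union>j. F i j)"
    have const: "g i x (N + n) = g i x N" for n
      by (induction n) (use st in auto)
    obtain m where m: "cyl x m \<inter> F i (g i x N) = {}"
      using closed_cyl_disjoint[OF F] nx by blast
    \<comment> \<open>Late enough that the guess is frozen, the cylinder misses
      \<open>F i (g i x N)\<close>, and \<open>n\<close> exceeds the guess: both disjuncts of
      \<open>g_prop\<close> fail.\<close>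
    define n where "n = N + m + Suc (g i x N)"
    have "g i x n = g i x N" unfolding n_def using const[of "m + Suc (g i x N)"] by (simp add: add.assoc)
    moreover have "cyl x n \<subseteq> cyl x m" by (rule cyl_antimono) (simp add: n_def)
    ultimately show False using g_prop[of n i x] m by (auto simp: n_def)
  qed
  have "x \<in> X \<longleftrightarrow> (\<forall>k. \<exists>N. \<forall>n\<ge>N. k \<le> a x n)" for x
  proof
    assume x: "x \<in> X"
    show "\<forall>k. \<exists>N. \<forall>n\<ge>N. k \<le> a x n"
    proof
      fix k
      have "\<exists>N. \<forall>n\<ge>N. g i x n = g i x (n - 1)" for i using stab x X by blast
      then obtain N where N: "\<And>i n. n \<ge> N i \<Longrightarrow> g i x n = g i x (n - 1)" by metis
      \<comment> \<open>The summand \<open>k\<close> excludes the default case of the rank; the sum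
        dominates every \<open>N i\<close> with \<open>i < k\<close>.\<close>
      define M where "M = k + (\<Sum>i<k. N i)"
      have "k \<le> a x n" if n: "n \<ge> M" for n
      proof (rule ccontr)
        assume c: "\<not> k \<le> a x n"
        have "n \<le> a x n \<or> g (a x n) x n \<noteq> g (a x n) x (n - 1)"
          unfolding a_def by (rule LeastI[of _ n]) simp
        moreover have "N (a x n) \<le> (\<Sum>i<k. N i)"
          using c by (intro member_le_sum) auto
        ultimately show False using N[of "a x n" n] c n by (auto simp: M_def)
      qed
      then show "\<exists>N. \<forall>n\<ge>N. k \<le> a x n" by blast
    qed
  next
    assume r: "\<forall>k. \<exists>N. \<forall>n\<ge>N. k \<le> a x n"
    have "x \<in> (\<Union>j. F i j)" for i
    proof -
      obtain N where N: "\<forall>n\<ge>N. Suc i \<le> a x n" using r by blast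
      have "g i x n = g i x (n - 1)" if "n \<ge> N" for n
      proof (rule ccontr)
        assume "g i x n \<noteq> g i x (n - 1)"
        then have "a x n \<le> i" unfolding a_def by (intro Least_le) simp
        then show False using N that by fastforce
      qed
      then show ?thesis by (intro unst) blast
    qed
    then show "x \<in> X" using X by blast
  qed
  then show ?thesis using a_local by blast
qed

section \<open>The coin-tossing measure\<close>

abbreviation coin_pre :: "cantor measure" where
  "coin_pre \<equiv> Pi\<^sub>M UNIV (\<lambda>_. measure_pmf (bernoulli_pmf (1/2)))"

interpretation coin_pre: product_prob_space "\<lambda>_. measure_pmf (bernoulli_pmf (1/2))" "UNIV :: nat set"
  by unfold_locales

interpretation coin: prob_space coin
  unfolding coin_def by (rule prob_space.prob_space_completion) unfold_locales

lemma space_coin_pre [simp]: "space coin_pre = UNIV"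
  by (simp add: space_PiM)

lemma space_coin [simp]: "space coin = UNIV"
  by (simp add: coin_def)

lemma sets_coin_preI: "S \<in> sets coin_pre \<Longrightarrow> S \<in> sets coin"
  by (simp add: coin_def sets_completionI_sets)

text \<open>Initial segments alone would not do: the exit events below fix a prefix together with
  scattered odd positions.\<close>

lemma finite_cylinder:
  assumes "finite J"
  shows "{y. \<forall>i\<in>J. y i = b i} \<in> sets coin"
    and "measure coin {y. \<forall>i\<in>J. y i = b i} = (1/2) ^ card J"
proof -
  have eq: "{y. \<forall>i\<in>J. y i = b i} = {y\<in>space coin_pre. \<forall>i\<in>J. y i \<in> {b i}}" by auto
  have s: "{y. \<forall>i\<in>J. y i = b i} \<in> sets coin_pre"
    unfolding eq
  proof (rule sets.sets_Collect_finite_All[OF _ assms])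
    fix i
    have "(\<lambda>y. y i) -` {b i} \<inter> space coin_pre \<in> sets coin_pre"
      by (rule measurable_sets[OF measurable_component_singleton]) auto
    then show "{y \<in> space coin_pre. y i \<in> {b i}} \<in> sets coin_pre"
      by (simp add: vimage_def)
  qed
  then show "{y. \<forall>i\<in>J. y i = b i} \<in> sets coin" by (rule sets_coin_preI)
  have half: "emeasure (measure_pmf (bernoulli_pmf (1/2))) {c} = ennreal (1/2)" for c
    by (cases c) (simp_all add: emeasure_pmf_single)
  have "emeasure coin_pre {y. \<forall>i\<in>J. y i = b i} = (\<Prod>i\<in>J. ennreal (1/2))"
    unfolding eq using assms by (subst coin_pre.emeasure_PiM_Collect) (simp_all add: half)
  also have "\<dots> = ennreal ((1/2) ^ card J)"
    by (simp only: prod_constant ennreal_power)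
  finally show "measure coin {y. \<forall>i\<in>J. y i = b i} = (1/2) ^ card J"
    using s by (simp add: coin_def measure_def)
qed

lemma cyl_measurable: "cyl x n \<in> sets coin"
  using finite_cylinder(1)[of "{..<n}" x] by (simp add: cyl_def Ball_def)

lemma measure_cyl: "measure coin (cyl x n) = (1/2) ^ n"
  using finite_cylinder(2)[of "{..<n}" x] by (simp add: cyl_def Ball_def)

lemma open_measurable:
  assumes "cantor_open U"
  shows "U \<in> sets coin"
proof -
  define I where "I = {s. nbhd s \<subseteq> U}"
  have "U = (\<Union>s\<in>I. nbhd s)"
  proof
    show "U \<subseteq> (\<Union>s\<in>I. nbhd s)"
      using assms unfolding cantor_open_def I_def by (fastforce simp: nbhd_restr)
  qed (auto simp: I_def)
  moreover have "nbhd s \<in> sets coin" for s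
    using finite_cylinder(1)[of "{..<length s}" "\<lambda>i. s ! i"] by (simp add: nbhd_def Ball_def)
  then have "(\<Union>s\<in>I. nbhd s) \<in> sets coin"
    by (intro sets.countable_UN') auto
  ultimately show ?thesis by simp
qed

lemma finite_depth_measurable:
  assumes "\<And>x y. y \<in> cyl x L \<Longrightarrow> y \<in> D \<longleftrightarrow> x \<in> D"
  shows "D \<in> sets coin"
  by (rule open_measurable) (use assms in \<open>auto simp: cantor_open_iff\<close>)

section \<open>Approximation of measurable sets by clopen sets\<close>

lemma measure_symdiff_triangle:
  assumes "A \<in> sets coin" "B \<in> sets coin" "C \<in> sets coin"
  shows "measure coin (symdiff A C) \<le> measure coin (symdiff A B) + measure coin (symdiff B C)"
proof -
  have "measure coin (symdiff A C) \<le> measure coin (symdiff A B \<union> symdiff B C)"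
    using assms by (intro coin.finite_measure_mono) (auto simp: symdiff_def)
  also have "\<dots> \<le> measure coin (symdiff A B) + measure coin (symdiff B C)"
    using assms by (intro measure_Un_le) (auto simp: symdiff_def)
  finally show ?thesis .
qed

text \<open>By compactness these are exactly the clopen sets.\<close>

definition finite_depth :: "cantor set \<Rightarrow> bool" where
  "finite_depth D \<longleftrightarrow> (\<exists>L. \<forall>x. \<forall>y\<in>cyl x L. y \<in> D \<longleftrightarrow> x \<in> D)"

lemma finite_depth_sets: "finite_depth D \<Longrightarrow> D \<in> sets coin"
  unfolding finite_depth_def using finite_depth_measurable[of _ D] by blast

lemma finite_depth_Un:
  assumes "finite_depth D" "finite_depth E"
  shows "finite_depth (D \<union> E)"
proof -
  obtain L M where LM: "\<And>x y. y \<in> cyl x L \<Longrightarrow> y \<in> D \<longleftrightarrow> x \<in> D" "\<And>x y. y \<in> cyl x M \<Longrightarrow> y \<in> E \<longleftrightarrow> x \<in> E"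
    using assms unfolding finite_depth_def by metis
  have "y \<in> D \<union> E \<longleftrightarrow> x \<in> D \<union> E" if "y \<in> cyl x (max L M)" for x y
    using LM[of y x] that cyl_antimono[of L "max L M" x] cyl_antimono[of M "max L M" x] by auto
  then show ?thesis unfolding finite_depth_def by blast
qed

lemma finite_depth_UN:
  fixes D :: "nat \<Rightarrow> cantor set"
  assumes "\<And>i. finite_depth (D i)"
  shows "finite_depth (\<Union>i<n. D i)"
proof (induction n)
  case 0
  show ?case by (simp add: finite_depth_def)
next
  case (Suc n)
  then show ?case using finite_depth_Un[OF assms[of n]] by (simp add: lessThan_Suc)
qed

text \<open>Induction on the generation of the sigma-algebra by one-coordinate events. The
  quantifier over \<open>e\<close> stays inside, so that a countable union can request smaller
  errors from its members.\<close>

lemma finite_depth_approx_pre: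
  assumes "A \<in> sets coin_pre"
  shows "\<forall>e>0. \<exists>D. finite_depth D \<and> measure coin (symdiff A D) < e"
proof -
  define G where "G = {{f\<in>\<Pi>\<^sub>E i\<in>UNIV. space (measure_pmf (bernoulli_pmf (1/2))). f i \<in> S} | i S.
      i \<in> (UNIV :: nat set) \<and> S \<in> sets (measure_pmf (bernoulli_pmf (1/2)))}"
  have G: "sets coin_pre = sigma_sets UNIV G"
    unfolding G_def by (subst sets_PiM_single) simp
  have "A \<in> sigma_sets UNIV G" using assms G by simp
  then show ?thesis
  proof induction
    case (Basic a)
    then obtain i :: nat and S where a: "a = {f. f i \<in> S}" unfolding G_def by auto
    have "\<forall>x. \<forall>y\<in>cyl x (Suc i). y \<in> a \<longleftrightarrow> x \<in> a"
      by (auto simp: a cyl_def)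
    then have "finite_depth a" unfolding finite_depth_def by blast
    then show ?case by (auto simp: symdiff_def intro!: exI[of _ a])
  next
    case Empty
    show ?case by (auto simp: symdiff_def finite_depth_def intro!: exI[of _ "{}"])
  next
    case (Compl a)
    show ?case
    proof (intro allI impI)
      fix e :: real assume "e > 0"
      then obtain D where D: "finite_depth D" "measure coin (symdiff a D) < e" using Compl by blast
      have "finite_depth (- D)" using D(1) unfolding finite_depth_def by auto
      moreover have "symdiff (UNIV - a) (- D) = symdiff a D" by (auto simp: symdiff_def)
      ultimately show "\<exists>D. finite_depth D \<and> measure coin (symdiff (UNIV - a) D) < e"
        using D(2) by metis
    qed
  next
    case (Union a)
    have am: "a i \<in> sets coin" for i
      using Union(1)[of i] G by (simp add: sets_coin_preI)
    show ?case
    proof (intro allI impI)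
      fix e :: real assume e: "e > 0"
      have "(\<lambda>n. measure coin (\<Union>i<n. a i)) \<longlonglongrightarrow> measure coin (\<Union>n. \<Union>i<n. a i)"
        using am by (intro coin.finite_Lim_measure_incseq) (auto simp: incseq_def intro: less_le_trans)
      moreover have "(\<Union>n. \<Union>i<n. a i) = (\<Union>i. a i)" by auto
      ultimately have "(\<lambda>n. measure coin (\<Union>i<n. a i)) \<longlonglongrightarrow> measure coin (\<Union>i. a i)" by simp
      then have "\<forall>\<^sub>F n in sequentially. measure coin (\<Union>i. a i) - e / 2 < measure coin (\<Union>i<n. a i)"
        using e by (intro order_tendstoD(1)) auto
      then obtain n where n: "measure coin (\<Union>i. a i) - e / 2 < measure coin (\<Union>i<n. a i)"
        using eventually_happens'[OF sequentially_bot] by blast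
      \<comment> \<open>Half of \<open>e\<close> pays for truncating the union, the other half is
        shared by \<open>n\<close> members; \<open>+ 1\<close> keeps the quotient positive for
        \<open>n = 0\<close>.\<close>
      have "\<forall>i. \<exists>D. finite_depth D \<and> measure coin (symdiff (a i) D) < e / (2 * (real n + 1))"
        using Union(2) e by simp
      from choice[OF this] obtain D where D: "\<And>i. finite_depth (D i)"
        "\<And>i. measure coin (symdiff (a i) (D i)) < e / (2 * (real n + 1))" by blast
      have Dm: "D i \<in> sets coin" for i using D(1) finite_depth_sets by blast
      have "measure coin (symdiff (\<Union>i. a i) (\<Union>i<n. a i)) = measure coin ((\<Union>i. a i) - (\<Union>i<n. a i))"
        by (rule arg_cong[where f="measure coin"]) (auto simp: symdiff_def)
      also have "\<dots> = measure coin (\<Union>i. a i) - measure coin (\<Union>i<n. a i)"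
        using am by (intro coin.finite_measure_Diff) auto
      finally have 1: "measure coin (symdiff (\<Union>i. a i) (\<Union>i<n. a i)) < e / 2" using n by simp
      have "measure coin (symdiff (\<Union>i<n. a i) (\<Union>i<n. D i)) \<le> measure coin (\<Union>i<n. symdiff (a i) (D i))"
        using am Dm by (intro coin.finite_measure_mono) (auto simp: symdiff_def)
      also have "\<dots> \<le> (\<Sum>i<n. measure coin (symdiff (a i) (D i)))"
        using am Dm by (intro coin.finite_measure_subadditive_finite) (auto simp: symdiff_def)
      also have "\<dots> \<le> (\<Sum>i<n. e / (2 * (real n + 1)))"
        using D(2) by (intro sum_mono less_imp_le) auto
      also have "\<dots> \<le> e / 2" using e by (simp add: field_simps)
      finally have "measure coin (symdiff (\<Union>i. a i) (\<Union>i<n. D i)) < e"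
        using 1 measure_symdiff_triangle[of "\<Union>i. a i" "\<Union>i<n. a i" "\<Union>i<n. D i"] am Dm by auto
      then show "\<exists>D. finite_depth D \<and> measure coin (symdiff (\<Union> (range a)) D) < e"
        using finite_depth_UN[of D, OF D(1)] by blast
    qed
  qed
qed

lemma finite_depth_approx:
  assumes "A \<in> sets coin" "e > 0"
  shows "\<exists>D. finite_depth D \<and> measure coin (symdiff A D) < e"
proof -
  obtain S N N' where A: "A = S \<union> N" "N \<subseteq> N'" "N' \<in> null_sets coin_pre" "S \<in> sets coin_pre"
    using assms(1) unfolding coin_def by (rule sets_completionE)
  obtain D where D: "finite_depth D" "measure coin (symdiff S D) < e"
    using finite_depth_approx_pre[OF A(4)] assms(2) by blast
  have N': "N' \<in> null_sets coin" using A(3) by (simp add: coin_def null_sets_completionI)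
  have S: "S \<in> sets coin" using A(4) by (rule sets_coin_preI)
  have "measure coin (symdiff A S) \<le> measure coin N'"
    using assms(1) S N' A by (intro coin.finite_measure_mono) (auto simp: symdiff_def)
  also have "\<dots> = 0" using N' by (simp add: measure_eq_0_null_sets)
  finally show ?thesis
    using measure_symdiff_triangle[OF assms(1) S finite_depth_sets[OF D(1)]] D by force
qed

section \<open>Density points\<close>

lemma Phi_compl_iff:
  assumes "A \<in> sets coin"
  shows "x \<in> Phi A \<longleftrightarrow> (\<lambda>n. measure coin (cyl x n - A) / (1/2) ^ n) \<longlonglongrightarrow> 0"
proof -
  have "measure coin (A \<inter> cyl x n) / (1/2) ^ n = 1 - measure coin (cyl x n - A) / (1/2) ^ n" for n
  proof -
    have "measure coin (cyl x n - A) = measure coin (cyl x n) - measure coin (cyl x n \<inter> A)"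
      using assms cyl_measurable by (intro coin.finite_measure_Diff')
    then show ?thesis by (simp add: measure_cyl Int_commute field_simps)
  qed
  then have "x \<in> Phi A \<longleftrightarrow> (\<lambda>n. 1 - measure coin (cyl x n - A) / (1/2) ^ n) \<longlonglongrightarrow> 1 - 0"
    by (simp add: Phi_def nbhd_restr measure_cyl)
  also have "\<dots> \<longleftrightarrow> (\<lambda>n. measure coin (cyl x n - A) / (1/2) ^ n) \<longlonglongrightarrow> 0"
    using tendsto_diff[OF tendsto_const[of "1::real"], of "\<lambda>n. 1 - measure coin (cyl x n - A) / (1/2) ^ n" "1 - 0" sequentially]
      tendsto_diff[OF tendsto_const[of "1::real"], of "\<lambda>n. measure coin (cyl x n - A) / (1/2) ^ n" 0 sequentially]
    by auto
  finally show ?thesis .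
qed

lemma Phi_inside:
  assumes "cyl x n \<subseteq> A"
  shows "x \<in> Phi A"
proof -
  have "A \<inter> cyl x m = cyl x m" if "m \<ge> n" for m
    using assms cyl_antimono[OF that, of x] by blast
  then have "\<forall>\<^sub>F m in sequentially. measure coin (A \<inter> cyl x m) / measure coin (cyl x m) = 1"
    by (intro eventually_sequentiallyI[of n]) (simp add: measure_cyl)
  then show ?thesis by (simp add: Phi_def nbhd_restr tendsto_eventually)
qed

lemma Phi_outside:
  assumes "cyl x n \<inter> A = {}"
  shows "x \<notin> Phi A"
proof
  assume x: "x \<in> Phi A"
  have "A \<inter> cyl x m = {}" if "m \<ge> n" for m
    using assms cyl_antimono[OF that, of x] by blast
  then have "\<forall>\<^sub>F m in sequentially. measure coin (A \<inter> cyl x m) / measure coin (cyl x m) = 0"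
    by (intro eventually_sequentiallyI[of n]) simp
  then have "(\<lambda>m. measure coin (A \<inter> cyl x m) / measure coin (cyl x m)) \<longlonglongrightarrow> 0"
    by (rule tendsto_eventually)
  then show False
    using x LIMSEQ_unique by (fastforce simp: Phi_def nbhd_restr)
qed

lemma Phi_Un_null:
  assumes "A \<in> sets coin" "N \<in> null_sets coin"
  shows "Phi (A \<union> N) = Phi A"
proof -
  have "measure coin ((A \<union> N) \<inter> cyl x n) = measure coin (A \<inter> cyl x n)" for x n
    unfolding Int_Un_distrib2 using assms cyl_measurable
    by (intro measure_Un_null_set) (auto intro: null_set_Int2)
  then show ?thesis by (simp add: Phi_def nbhd_restr)
qed

section \<open>The spine and the stage at which a point leaves it\<close>

definition spine :: "cantor set" where
  "spine = {y. \<forall>i. \<not> y (2 * i + 1)}"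

text \<open>On the spine no bit qualifies and the value is arbitrary; \<open>B\<close> and
  \<open>red\<close> treat the spine separately.\<close>

definition exit_stage :: "cantor \<Rightarrow> nat" where
  "exit_stage y = (LEAST n. y (2 * n + 1))"

definition enc :: "cantor \<Rightarrow> cantor" where
  "enc x m \<longleftrightarrow> even m \<and> x (m div 2)"

definition dec :: "cantor \<Rightarrow> cantor" where
  "dec y i = y (2 * i)"

lemma dec_enc [simp]: "dec (enc x) = x"
  by (auto simp: dec_def enc_def)

lemma enc_odd [simp]: "\<not> enc x (2 * i + 1)" "\<not> enc x (Suc (2 * i))"
  by (auto simp: enc_def)

lemma enc_dec: "y \<in> spine \<Longrightarrow> enc (dec y) = y"
proof
  fix m assume "y \<in> spine"
  then show "enc (dec y) m = y m"
    by (cases "even m") (auto simp: enc_def dec_def spine_def elim!: oddE)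
qed

lemma dec_cyl: "z \<in> cyl y m \<Longrightarrow> 2 * n \<le> m \<Longrightarrow> dec z \<in> cyl (dec y) n"
  by (auto simp: cyl_def dec_def)

lemma enc_continuous: "cantor_continuous enc"
proof (rule cantor_continuousI)
  fix x n
  show "\<exists>m. \<forall>y\<in>cyl x m. enc y \<in> cyl (enc x) n"
    by (rule exI[of _ n]) (auto simp: cyl_def enc_def)
qed

lemma exit_stage_bit: "y \<notin> spine \<Longrightarrow> y (2 * exit_stage y + 1)"
  unfolding spine_def exit_stage_def by (auto intro: LeastI)

lemma exit_stage_before: "i < exit_stage y \<Longrightarrow> \<not> y (2 * i + 1)"
  unfolding exit_stage_def using not_less_Least by blast

lemma exit_stage_eqI:
  assumes "y (2 * n + 1)" "\<And>i. i < n \<Longrightarrow> \<not> y (2 * i + 1)"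
  shows "exit_stage y = n" "y \<notin> spine"
proof -
  show "exit_stage y = n"
    unfolding exit_stage_def by (rule Least_equality) (use assms in \<open>auto simp: not_less[symmetric]\<close>)
  show "y \<notin> spine" using assms by (auto simp: spine_def)
qed

lemma exit_stage_local:
  assumes "y \<notin> spine" "z \<in> cyl y m" "2 * exit_stage y + 2 \<le> m"
  shows "exit_stage z = exit_stage y" "z \<notin> spine"
proof -
  have "z (2 * exit_stage y + 1)" "\<And>i. i < exit_stage y \<Longrightarrow> \<not> z (2 * i + 1)"
    using assms exit_stage_bit[OF assms(1)] exit_stage_before[of _ y] by (auto simp: cyl_def)
  then show "exit_stage z = exit_stage y" "z \<notin> spine"
    using exit_stage_eqI by blast+
qed

lemma spine_closed: "cantor_closed spine"
  unfolding cantor_closed_def cantor_open_iff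
proof
  fix y assume "y \<in> - spine"
  then have "cyl y (2 * exit_stage y + 2) \<subseteq> - spine"
    using exit_stage_local(2)[of y] by blast
  then show "\<exists>n. cyl y n \<subseteq> - spine" by blast
qed

section \<open>Measures of exit events\<close>

lemma ball_lessThan_iff: "(\<forall>i\<in>{..<n}. P i) \<longleftrightarrow> (\<forall>i<n. P i)" for n :: nat
  by auto

lemma card_lessThan_Un_odd:
  assumes "m \<le> 2 * n + 1"
  shows "card ({..<m} \<union> (\<lambda>i. 2 * (n + i) + 1) ` {..<k}) = m + k"
proof -
  have "{..<m} \<inter> (\<lambda>i. 2 * (n + i) + 1) ` {..<k} = {}" using assms by fastforce
  moreover have "card ((\<lambda>i. 2 * (n + i) + 1) ` {..<k}) = k"
    by (subst card_image) (auto simp: inj_on_def)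
  ultimately show ?thesis by (simp add: card_Un_disjoint)
qed

text \<open>Each vanishing odd bit halves the measure; \<open>m \<le> 2 * n + 1\<close> keeps the
  prefix clear of these positions. Such sets bound the spine, the difference of \<open>B\<close> and
  \<open>D\<close>, and the late exits.\<close>

lemma late_exit_measure:
  assumes "m \<le> 2 * n + 1"
  shows "{y\<in>cyl x m. \<forall>i<k. \<not> y (2 * (n + i) + 1)} \<in> sets coin"
    and "measure coin {y\<in>cyl x m. \<forall>i<k. \<not> y (2 * (n + i) + 1)} = (1/2) ^ (m + k)"
proof -
  define J where "J = {..<m} \<union> (\<lambda>i. 2 * (n + i) + 1) ` {..<k}"
  define b where "b i \<longleftrightarrow> i < m \<and> x i" for i
  have eq: "{y\<in>cyl x m. \<forall>i<k. \<not> y (2 * (n + i) + 1)} = {y. \<forall>i\<in>J. y i = b i}"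
  proof -
    have "\<forall>i<m. b i = x i" "\<forall>i<k. \<not> b (2 * (n + i) + 1)" using assms by (auto simp: b_def)
    then show ?thesis by (simp add: J_def cyl_def ball_Un ball_lessThan_iff)
  qed
  have "card J = m + k" unfolding J_def using assms by (rule card_lessThan_Un_odd)
  moreover have "finite J" by (simp add: J_def)
  ultimately show "{y\<in>cyl x m. \<forall>i<k. \<not> y (2 * (n + i) + 1)} \<in> sets coin"
    and "measure coin {y\<in>cyl x m. \<forall>i<k. \<not> y (2 * (n + i) + 1)} = (1/2) ^ (m + k)"
    unfolding eq using finite_cylinder[of J b] by simp_all
qed

text \<open>An exit bit (\<open>i = 0\<close>) followed by \<open>M\<close> ones. Where the window
  is mixed, \<open>B\<close> omits runs of this kind: for rank at least \<open>M\<close> the omitted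
  points lie in such a run, for rank at most \<open>M\<close> the whole run is omitted.\<close>

definition exit_run :: "cantor \<Rightarrow> nat \<Rightarrow> nat \<Rightarrow> nat \<Rightarrow> nat \<Rightarrow> cantor set" where
  "exit_run x m n k M = {y\<in>cyl x m. (\<forall>i<k. \<not> y (2 * (n + i) + 1)) \<and>
     (\<forall>i\<le>M. y (2 * (n + k) + 1 + i))}"

lemma exit_run_measure:
  assumes "m \<le> 2 * n + 1"
  shows "exit_run x m n k M \<in> sets coin"
    and "measure coin (exit_run x m n k M) = (1/2) ^ (m + k + M + 1)"
proof -
  define J1 where "J1 = {..<m} \<union> (\<lambda>i. 2 * (n + i) + 1) ` {..<k}"
  define J2 where "J2 = (\<lambda>i. 2 * (n + k) + 1 + i) ` {..M}"
  define b where "b i \<longleftrightarrow> (if i < m then x i else i \<in> J2)" for i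
  have disj: "J1 \<inter> J2 = {}" using assms by (auto simp: J1_def J2_def)
  have eq: "exit_run x m n k M = {y. \<forall>i\<in>J1 \<union> J2. y i = b i}"
  proof -
    have J2: "\<not> i < m \<and> b i" if "i \<in> J2" for i
      using that assms by (auto simp: J2_def b_def)
    have "\<not> b (2 * (n + i) + 1)" if "i < k" for i
    proof -
      have "2 * (n + i) + 1 \<notin> J2" using that by (auto simp: J2_def)
      then show ?thesis using assms by (simp add: b_def)
    qed
    then have e1: "(\<forall>i\<in>J1. y i = b i) \<longleftrightarrow> y \<in> cyl x m \<and> (\<forall>i<k. \<not> y (2 * (n + i) + 1))" for y
      by (simp add: J1_def cyl_def ball_Un ball_lessThan_iff b_def)
    have e2: "(\<forall>i\<in>J2. y i = b i) \<longleftrightarrow> (\<forall>i\<le>M. y (2 * (n + k) + 1 + i))" for y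
    proof -
      have "(\<forall>i\<in>J2. y i = b i) \<longleftrightarrow> (\<forall>i\<in>J2. y i)" using J2 by auto
      also have "\<dots> \<longleftrightarrow> (\<forall>i\<le>M. y (2 * (n + k) + 1 + i))" unfolding J2_def by blast
      finally show ?thesis .
    qed
    show ?thesis unfolding exit_run_def ball_Un e1 e2 by (simp add: conj_assoc)
  qed
  have "card J1 = m + k" unfolding J1_def using assms by (rule card_lessThan_Un_odd)
  moreover have "card J2 = M + 1"
    unfolding J2_def by (subst card_image) (auto simp: inj_on_def)
  moreover have fin: "finite J1" "finite J2" by (simp_all add: J1_def J2_def)
  ultimately have "card (J1 \<union> J2) = m + k + M + 1"
    using disj by (simp add: card_Un_disjoint)
  then show "exit_run x m n k M \<in> sets coin"
    and "measure coin (exit_run x m n k M) = (1/2) ^ (m + k + M + 1)"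
    unfolding eq using finite_cylinder[of "J1 \<union> J2" b] fin by simp_all
qed

lemma spine_null: "spine \<in> null_sets coin"
proof -
  have "- spine \<in> sets coin"
    using spine_closed open_measurable unfolding cantor_closed_def by blast
  then have s: "spine \<in> sets coin"
    using sets.compl_sets[of "- spine" coin] by (simp add: Compl_eq_Diff_UNIV[symmetric])
  have "measure coin spine \<le> (1/2) ^ k" for k
  proof -
    \<comment> \<open>\<open>cyl undefined 0\<close> is the whole space, so only the first
      \<open>k\<close> odd bits matter.\<close>
    have "measure coin spine \<le> measure coin {y\<in>cyl undefined 0. \<forall>i<k. \<not> y (2 * (0 + i) + 1)}"
      by (rule coin.finite_measure_mono)
        (auto simp: spine_def cyl_def intro: late_exit_measure(1)[of 0 0 undefined, simplified cyl_def, simplified])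
    then show ?thesis using late_exit_measure(2)[of 0 0 undefined k] by simp
  qed
  then have "measure coin spine \<le> 0"
    by (intro LIMSEQ_le_const[OF LIMSEQ_realpow_zero[of "1/2::real"]]) auto
  then have "measure coin spine = 0" using measure_nonneg[of coin spine] by linarith
  then show ?thesis using s by (simp add: null_sets_def coin.emeasure_eq_measure)
qed

section \<open>A set whose density along the spine codes \<open>X\<close>\<close>

lemma sum_half_powers: "(\<Sum>k<n. (1/2::real) ^ (k + 1)) = 1 - (1/2) ^ n"
  by (induction n) auto

text \<open>\<open>D\<close> is the clopen approximation followed by exits before stage
  \<open>l\<close>; later exits code \<open>X\<close> through the rank \<open>a\<close>.\<close>

locale density_coding =
  fixes X D :: "cantor set" and a :: "cantor \<Rightarrow> nat \<Rightarrow> nat" and L l :: nat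
  assumes a_local: "\<And>x y n. y \<in> cyl x n \<Longrightarrow> a y n = a x n"
    and X_iff: "\<And>x. x \<in> X \<longleftrightarrow> (\<forall>k. \<exists>N. \<forall>n\<ge>N. k \<le> a x n)"
    and D_local: "\<And>x y. y \<in> cyl x L \<Longrightarrow> y \<in> D \<longleftrightarrow> x \<in> D"
    and X_nonempty: "X \<noteq> {}" and X_proper: "X \<noteq> UNIV"
begin

text \<open>Looking only at half of the bits decoded so far makes all points close to \<open>enc x\<close> that
  leave the spine before stage \<open>2 n\<close> use the rank of a prefix of \<open>x\<close>, so that the two halves of
  a cylinder at a branching of the spine cannot have very different densities.\<close>

definition window :: "cantor \<Rightarrow> cantor set" where
  "window y = cyl (dec y) (exit_stage y div 2)"

text \<open>On a mixed window the negated existential is a run of ones right after the exit bit, of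
  relative measure 1/2 to the power of the rank; rank 0 removes the whole cylinder.\<close>

definition B :: "cantor set" where
  "B = {y. y \<notin> spine \<and>
     (if exit_stage y < l then y \<in> D
      else window y \<subseteq> X \<or> window y \<inter> X \<noteq> {} \<and>
        (\<exists>i<a (dec y) (exit_stage y div 2). \<not> y (2 * exit_stage y + 2 + i)))}"

text \<open>\<open>L\<close> bits settle \<open>D\<close>, the next
  \<open>2 * exit_stage y + 2\<close> the exit and the window, the last summand the run after the
  exit bit.\<close>

lemma B_local:
  assumes y: "y \<notin> spine"
    and z: "z \<in> cyl y (L + 2 * exit_stage y + 2 + a (dec y) (exit_stage y div 2))"
  shows "z \<notin> spine" "exit_stage z = exit_stage y" "window z = window y" "z \<in> B \<longleftrightarrow> y \<in> B"
proof -
  show 1: "z \<notin> spine" "exit_stage z = exit_stage y"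
    using exit_stage_local[OF y z] by simp_all
  have dec: "dec z \<in> cyl (dec y) (exit_stage y div 2)"
    by (rule dec_cyl[OF z]) linarith
  then show 2: "window z = window y" by (simp add: window_def 1 cyl_eqI)
  have 3: "a (dec z) (exit_stage y div 2) = a (dec y) (exit_stage y div 2)"
    using a_local[OF dec] .
  have "z \<in> cyl y L" using z by (auto simp: cyl_def)
  then have 4: "z \<in> D \<longleftrightarrow> y \<in> D" by (rule D_local)
  have 5: "z (2 * exit_stage y + 2 + i) = y (2 * exit_stage y + 2 + i)"
    if "i < a (dec y) (exit_stage y div 2)" for i
    using z that by (simp add: cyl_def)
  have "(\<exists>i<a (dec y) (exit_stage y div 2). \<not> z (2 * exit_stage y + 2 + i)) \<longleftrightarrow>
        (\<exists>i<a (dec y) (exit_stage y div 2). \<not> y (2 * exit_stage y + 2 + i))"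
    using 5 by blast
  then show "z \<in> B \<longleftrightarrow> y \<in> B" unfolding B_def using 1 2 3 4 y by simp
qed

lemma B_open: "cantor_open B"
  unfolding cantor_open_iff
proof
  fix y assume y: "y \<in> B"
  then have "y \<notin> spine" by (simp add: B_def)
  from B_local(4)[OF this] y show "\<exists>n. cyl y n \<subseteq> B" by blast
qed

lemma B_spine_closed: "cantor_closed (B \<union> spine)"
  unfolding cantor_closed_def cantor_open_iff
proof
  fix y assume y: "y \<in> - (B \<union> spine)"
  then have "y \<notin> spine" by simp
  from B_local(1,4)[OF this] y show "\<exists>n. cyl y n \<subseteq> - (B \<union> spine)" by blast
qed

lemma B_sets: "B \<in> sets coin"
  using B_open by (rule open_measurable)

lemma Phi_off_spine:
  assumes "y \<notin> spine"
  shows "y \<in> Phi B \<longleftrightarrow> y \<in> B"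
proof (cases "y \<in> B")
  case True
  then have "cyl y (L + 2 * exit_stage y + 2 + a (dec y) (exit_stage y div 2)) \<subseteq> B"
    using B_local(4)[OF assms] by blast
  then show ?thesis using True Phi_inside by blast
next
  case False
  then have "cyl y (L + 2 * exit_stage y + 2 + a (dec y) (exit_stage y div 2)) \<inter> B = {}"
    using B_local(4)[OF assms] by blast
  then show ?thesis using False Phi_outside by blast
qed

text \<open>The sets agree at every point leaving the spine before stage \<open>l\<close>; all other
  points have their first \<open>l\<close> odd bits zero.\<close>

lemma symdiff_B_D: "measure coin (symdiff D B) \<le> (1/2) ^ l"
proof -
  have "symdiff D B \<subseteq> {y\<in>cyl undefined 0. \<forall>i<l. \<not> y (2 * (0 + i) + 1)}"
  proof
    fix y assume y: "y \<in> symdiff D B"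
    have "\<not> y (2 * i + 1)" if "i < l" for i
    proof (cases "y \<in> spine")
      case False
      then have "\<not> exit_stage y < l" using y by (auto simp: symdiff_def B_def)
      then show ?thesis using that exit_stage_before[of i y] by simp
    qed (simp add: spine_def)
    then show "y \<in> {y\<in>cyl undefined 0. \<forall>i<l. \<not> y (2 * (0 + i) + 1)}"
      by (simp add: cyl_def)
  qed
  then have "measure coin (symdiff D B) \<le>
      measure coin {y\<in>cyl undefined 0. \<forall>i<l. \<not> y (2 * (0 + i) + 1)}"
    by (rule coin.finite_measure_mono) (rule late_exit_measure(1), simp)
  then show ?thesis using late_exit_measure(2)[of 0 0 undefined l] by simp
qed

text \<open>Points near \<open>enc x\<close> are sorted by exit stage. Exits at stage
  \<open>n + k\<close> have relative measure \<open>(1/2) ^ (k + 1)\<close>, and \<open>B\<close>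
  omits at most a fraction \<open>(1/2) ^ M\<close> of each; points still on course after
  \<open>n\<close> further stages are too rare to matter.\<close>

lemma enc_in_Phi:
  assumes x: "x \<in> X"
  shows "enc x \<in> Phi B"
proof -
  have bound: "\<exists>N. \<forall>m\<ge>N. measure coin (cyl (enc x) m - B) / (1/2) ^ m \<le> (1/2) ^ M + (1/2) ^ M" for M
  proof -
    obtain N where N: "\<And>n. n \<ge> N \<Longrightarrow> M \<le> a x n" using x X_iff by blast
    have "measure coin (cyl (enc x) m - B) / (1/2) ^ m \<le> (1/2) ^ M + (1/2) ^ M"
      \<comment> \<open>In the resulting bound on \<open>n\<close>, \<open>2 * N\<close> makes
        windows long enough for rank \<open>M\<close>, \<open>l\<close> skips the stages copied from
        \<open>D\<close>, and \<open>M\<close> makes the tail \<open>T\<close> small.\<close>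
      if m: "m \<ge> 2 * (2 * N + l + M)" for m
    proof -
      define n where "n = m div 2"
      have n: "n \<ge> 2 * N + l + M" "2 * n \<le> m" "m \<le> 2 * n + 1" using m unfolding n_def by auto
      define T where "T = {y\<in>cyl (enc x) m. \<forall>i<n. \<not> y (2 * (n + i) + 1)}"
      note T = late_exit_measure[OF n(3), of "enc x" n, folded T_def]
      note E = exit_run_measure[OF n(3), of "enc x" _ M]
      have "cyl (enc x) m - B \<subseteq> (\<Union>k<n. exit_run (enc x) m n k M) \<union> T"
      proof
        fix y assume y: "y \<in> cyl (enc x) m - B"
        show "y \<in> (\<Union>k<n. exit_run (enc x) m n k M) \<union> T"
        proof (cases "y \<in> T")
          case False
          define k where "k = (LEAST k. y (2 * (n + k) + 1))"
          obtain k' where k': "k' < n" "y (2 * (n + k') + 1)" using False y unfolding T_def by blast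
          have k: "y (2 * (n + k) + 1)" "k < n" "\<And>i. i < k \<Longrightarrow> \<not> y (2 * (n + i) + 1)"
            unfolding k_def using k' LeastI[of "\<lambda>k. y (2 * (n + k) + 1)" k']
              Least_le[of "\<lambda>k. y (2 * (n + k) + 1)" k'] not_less_Least by (blast, linarith, blast)
          have "\<not> y (2 * i + 1)" if "i < n + k" for i
          proof (cases "i < n")
            case True
            then have "y (2 * i + 1) = enc x (2 * i + 1)" using y n(2) by (simp add: cyl_def)
            then show ?thesis by simp
          next
            case False
            then show ?thesis using k(3)[of "i - n"] that by simp
          qed
          then have st: "exit_stage y = n + k" "y \<notin> spine" using exit_stage_eqI k(1) by blast+
          define j where "j = (n + k) div 2"
          have "2 * j \<le> n + k" "n + k \<le> 2 * j + 1" unfolding j_def by simp_all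
          \<comment> \<open>As \<open>n + k < 2 * n\<close>, the halved window stays inside the
            known prefix, so \<open>y\<close> is judged by a prefix of \<open>x\<close>.\<close>
          then have "2 * j \<le> m" "N \<le> j" using n k(2) by linarith+
          then have dec: "dec y \<in> cyl x j" using y dec_cyl[of y "enc x" m j] by simp
          then have "window y = cyl x j" by (simp add: window_def st j_def[symmetric] cyl_eqI)
          then have "window y \<inter> X \<noteq> {}" using x by auto
          \<comment> \<open>The window meets \<open>X\<close>, so \<open>y\<close> can miss
            \<open>B\<close> only through the run of ones.\<close>
          then have "\<forall>i<a (dec y) j. y (2 * (n + k) + 2 + i)"
            using y st n(1) by (auto simp: B_def j_def[symmetric])
          moreover have "M \<le> a (dec y) j" using a_local[OF dec] N[OF \<open>N \<le> j\<close>] by simp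
          ultimately have run: "y (2 * (n + k) + 2 + i)" if "i < M" for i using that by simp
          have "y (2 * (n + k) + 1 + i)" if "i \<le> M" for i
          proof (cases i)
            case 0
            then show ?thesis using k(1) by simp
          next
            case (Suc i')
            then show ?thesis using run[of i'] that by simp
          qed
          then have "y \<in> exit_run (enc x) m n k M" using y k(3) by (simp add: exit_run_def)
          then show ?thesis using k(2) by blast
        qed simp
      qed
      then have "measure coin (cyl (enc x) m - B) \<le> measure coin ((\<Union>k<n. exit_run (enc x) m n k M) \<union> T)"
        using E(1) T(1) by (intro coin.finite_measure_mono) auto
      also have "\<dots> \<le> measure coin (\<Union>k<n. exit_run (enc x) m n k M) + measure coin T"
        using E(1) T(1) by (intro measure_Un_le) auto
      also have "measure coin (\<Union>k<n. exit_run (enc x) m n k M)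
          \<le> (\<Sum>k<n. measure coin (exit_run (enc x) m n k M))"
        using E(1) by (intro coin.finite_measure_subadditive_finite) auto
      also have "\<dots> = (1/2) ^ (m + M) * (\<Sum>k<n. (1/2) ^ (k + 1))"
        by (simp add: E(2) sum_distrib_left power_add mult_ac)
      also have "\<dots> \<le> (1/2) ^ (m + M) * 1"
        by (intro mult_left_mono) (simp_all only: sum_half_powers, auto)
      also have "measure coin T \<le> (1/2) ^ (m + M)"
        unfolding T(2) using n(1) by (intro power_decreasing) auto
      finally have "measure coin (cyl (enc x) m - B) \<le> (1/2) ^ (m + M) * 1 + (1/2) ^ (m + M)"
        by simp
      then show ?thesis by (simp add: power_add field_simps)
    qed
    then show ?thesis by blast
  qed
  have "(\<lambda>m. measure coin (cyl (enc x) m - B) / (1/2) ^ m) \<longlonglongrightarrow> 0"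
  proof (rule LIMSEQ_I)
    fix e :: real assume e: "e > 0"
    obtain M where M: "(1/2::real) ^ M < e / 2" using real_arch_pow_inv[of "e / 2" "1/2"] e by auto
    obtain N where "\<forall>m\<ge>N. measure coin (cyl (enc x) m - B) / (1/2) ^ m \<le> (1/2) ^ M + (1/2) ^ M"
      using bound by blast
    then have "\<forall>m\<ge>N. measure coin (cyl (enc x) m - B) / (1/2) ^ m < e" using M by fastforce
    then show "\<exists>N. \<forall>m\<ge>N. norm (measure coin (cyl (enc x) m - B) / (1/2) ^ m - 0) < e"
      by (auto intro!: exI[of _ N])
  qed
  then show ?thesis using Phi_compl_iff[OF B_sets] by blast
qed

text \<open>Some \<open>k\<close> exceeds the rank at infinitely many prefixes of \<open>x\<close>.
  Just before each corresponding exit, a fixed proportion \<open>(1/2) ^ (k + 1)\<close> of the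
  cylinder lies outside \<open>B\<close>, so the omitted density cannot tend to 0.\<close>

lemma enc_notin_Phi:
  assumes x: "x \<notin> X"
  shows "enc x \<notin> Phi B"
proof
  assume "enc x \<in> Phi B"
  then have lim: "(\<lambda>m. measure coin (cyl (enc x) m - B) / (1/2) ^ m) \<longlonglongrightarrow> 0"
    using Phi_compl_iff[OF B_sets] by blast
  obtain k where k: "\<And>N. \<exists>j\<ge>N. a x j < k" using x X_iff by (meson not_le)
  have "\<forall>\<^sub>F m in sequentially. measure coin (cyl (enc x) m - B) / (1/2) ^ m < (1/2) ^ (k + 1)"
    using lim by (rule order_tendstoD(2)) simp
  then obtain N where N: "\<And>m. m \<ge> N \<Longrightarrow> measure coin (cyl (enc x) m - B) / (1/2) ^ m < (1/2) ^ (k + 1)"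
    unfolding eventually_sequentially by blast
  obtain j where j: "j \<ge> N + l" "a x j < k" using k by blast
  \<comment> \<open>\<open>n = 2 * j\<close> turns the window of an exit at stage \<open>n\<close>
    into \<open>cyl x j\<close>. Length \<open>2 * n + 1\<close> stops right before the exit bit, so
    exiting costs one bit and the run \<open>k\<close> more.\<close>
  define n m where "n = 2 * j" and "m = 2 * n + 1"
  note E = exit_run_measure[of m n "enc x" 0 k]
  have "exit_run (enc x) m n 0 k \<subseteq> cyl (enc x) m - B"
  proof
    fix y assume y: "y \<in> exit_run (enc x) m n 0 k"
    then have ym: "y \<in> cyl (enc x) m" and run: "\<And>i. i \<le> k \<Longrightarrow> y (2 * n + 1 + i)"
      by (auto simp: exit_run_def)
    have "\<not> y (2 * i + 1)" if "i < n" for i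
    proof -
      have "y (2 * i + 1) = enc x (2 * i + 1)" using ym that by (simp add: cyl_def m_def)
      then show ?thesis by simp
    qed
    then have st: "exit_stage y = n" "y \<notin> spine" using exit_stage_eqI run[of 0] by auto
    have dec: "dec y \<in> cyl x j" using dec_cyl[OF ym, of j] by (simp add: m_def n_def)
    have "window y = cyl x j" using dec by (simp add: window_def st n_def cyl_eqI)
    \<comment> \<open>\<open>x\<close> keeps the window from lying in \<open>X\<close>; if the
      window meets \<open>X\<close>, the run, longer than the rank, expels \<open>y\<close> from
      \<open>B\<close>.\<close>
    then have "\<not> window y \<subseteq> X" using x by auto
    moreover have "y (2 * n + 2 + i)" if "i < a (dec y) j" for i
      using run[of "Suc i"] that a_local[OF dec] j(2) by simp
    ultimately have "y \<notin> B" using st j(1) by (auto simp: B_def n_def)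
    then show "y \<in> cyl (enc x) m - B" using ym by blast
  qed
  then have "measure coin (exit_run (enc x) m n 0 k) \<le> measure coin (cyl (enc x) m - B)"
    using B_sets cyl_measurable by (intro coin.finite_measure_mono) auto
  then have "(1/2) ^ (m + (k + 1)) \<le> measure coin (cyl (enc x) m - B)"
    using E(2) by (simp add: m_def add.assoc)
  moreover have "m \<ge> N" using j(1) by (simp add: m_def n_def)
  ultimately show False using N[of m] by (simp add: power_add field_simps)
qed

lemma X_le_Phi: "wadge_le X (Phi B)"
  unfolding wadge_le_def using enc_continuous enc_in_Phi enc_notin_Phi by blast

section \<open>Reducing \<open>Phi B\<close> to \<open>X\<close>\<close>

definition target :: "cantor \<Rightarrow> cantor set" where
  "target y = (if exit_stage y < l then UNIV else window y)"

definition red :: "cantor \<Rightarrow> cantor" where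
  "red y = (if y \<in> spine then dec y else (SOME z. z \<in> target y \<and> (z \<in> X \<longleftrightarrow> y \<in> B)))"

text \<open>Early exits may use any point, as \<open>X\<close> is neither empty nor full. For later
  ones \<open>B\<close> agrees with every window lying inside or outside \<open>X\<close>, and a
  mixed window offers both answers.\<close>

lemma red_off_spine:
  assumes "y \<notin> spine"
  shows "red y \<in> target y" "red y \<in> X \<longleftrightarrow> y \<in> B"
proof -
  have "\<exists>z. z \<in> target y \<and> (z \<in> X \<longleftrightarrow> y \<in> B)"
  proof (cases "exit_stage y < l")
    case True
    then show ?thesis using X_nonempty X_proper by (auto simp: target_def)
  next
    case False
    have "window y \<noteq> {}" using cyl_self unfolding window_def by blast
    then have "window y \<inter> X \<noteq> {}" if "y \<in> B"
      using that False by (auto simp: B_def)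
    moreover have "\<not> window y \<subseteq> X" if "y \<notin> B"
      using that False assms by (auto simp: B_def)
    ultimately show ?thesis using False unfolding target_def by (cases "y \<in> B") auto
  qed
  from someI_ex[OF this] have "red y \<in> target y \<and> (red y \<in> X \<longleftrightarrow> y \<in> B)"
    using assms by (simp add: red_def)
  then show "red y \<in> target y" "red y \<in> X \<longleftrightarrow> y \<in> B" by blast+
qed

text \<open>Off the spine the predicate under \<open>SOME\<close> is locally constant, hence so is
  the chosen point. Near the spine exits come late, so windows shrink to the decoded point.\<close>

lemma red_continuous: "cantor_continuous red"
proof (rule cantor_continuousI)
  fix y n
  show "\<exists>m. \<forall>z\<in>cyl y m. red z \<in> cyl (red y) n"
  proof (cases "y \<in> spine")
    case False
    have "red z = red y" if "z \<in> cyl y (L + 2 * exit_stage y + 2 + a (dec y) (exit_stage y div 2))" for z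
      unfolding red_def target_def using B_local[OF False that] False by simp
    then show ?thesis by (metis cyl_self)
  next
    case True
    \<comment> \<open>This depth delays any exit to stage \<open>2 * n + l\<close>: \<open>l\<close>
      passes the unconstrained stages, \<open>2 * n\<close> allows for the halving in the
      window.\<close>
    have "red z \<in> cyl (dec y) n" if z: "z \<in> cyl y (2 * (2 * n + l))" for z
    proof -
      have dec: "dec z \<in> cyl (dec y) n" by (rule dec_cyl[OF z]) simp
      show ?thesis
      proof (cases "z \<in> spine")
        case True
        then show ?thesis using dec by (simp add: red_def)
      next
        case False
        have "\<not> exit_stage z < 2 * n + l"
        proof
          assume "exit_stage z < 2 * n + l"
          then have "z (2 * exit_stage z + 1) = y (2 * exit_stage z + 1)"
            using z by (simp add: cyl_def)
          then show False using exit_stage_bit[OF False] True by (simp add: spine_def)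
        qed
        then have "target z = cyl (dec z) (exit_stage z div 2)" "n \<le> exit_stage z div 2"
          by (auto simp: target_def window_def)
        then have "red z \<in> cyl (dec z) n"
          using red_off_spine(1)[OF False] cyl_antimono by blast
        then show ?thesis using cyl_eqI[OF dec] by simp
      qed
    qed
    moreover have "red y = dec y" using True by (simp add: red_def)
    ultimately show ?thesis by auto
  qed
qed

lemma Phi_le_X: "wadge_le (Phi B) X"
proof -
  have "y \<in> Phi B \<longleftrightarrow> red y \<in> X" for y
  proof (cases "y \<in> spine")
    case True
    then show ?thesis
      using enc_in_Phi[of "dec y"] enc_notin_Phi[of "dec y"] by (auto simp: red_def enc_dec)
  next
    case False
    then show ?thesis by (simp add: Phi_off_spine red_off_spine(2))
  qed
  then have "Phi B = red -` X" by blast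
  then show ?thesis unfolding wadge_le_def using red_continuous by blast
qed

end

theorem theorem1p8:
  fixes d :: "cantor set set" and A :: "cantor set" and \<epsilon> :: real
  assumes "wadge_degree d"
    and "\<forall>X\<in>d. Pi03 X"
    and "d \<noteq> {{}}" and "d \<noteq> {UNIV}"
    and "A \<in> sets coin" and "\<epsilon> > 0"
  shows "\<exists>B \<in> sets coin. measure coin (symdiff A B) < \<epsilon> \<and> Phi B \<in> d \<and>
           (\<exists>U C. cantor_open U \<and> cantor_closed C \<and> Phi B = Phi U \<and> Phi B = Phi C)"
proof -
  obtain X where d: "d = {Y. wadge_eq Y X}" using assms(1) unfolding wadge_degree_def by blast
  have "X \<in> d" using wadge_le_refl by (simp add: d wadge_eq_def)
  then have "Pi03 X" using assms(2) by blast
  from Pi03_rank[OF this] obtain a :: "cantor \<Rightarrow> nat \<Rightarrow> nat" where a: "\<And>x y n. y \<in> cyl x n \<Longrightarrow> a y n = a x n"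
    "\<And>x. x \<in> X \<longleftrightarrow> (\<forall>k. \<exists>N. \<forall>n\<ge>N. k \<le> a x n)"
    by metis
  have "X \<noteq> {}"
  proof
    assume "X = {}"
    then have "d \<subseteq> {{}}" by (auto simp: d wadge_eq_def wadge_le_def)
    then show False using \<open>X \<in> d\<close> assms(3) by blast
  qed
  have "X \<noteq> UNIV"
  proof
    assume "X = UNIV"
    then have "d \<subseteq> {UNIV}" by (auto simp: d wadge_eq_def wadge_le_def)
    then show False using \<open>X \<in> d\<close> assms(4) by blast
  qed
  \<comment> \<open>Half of \<open>\<epsilon>\<close> pays for the clopen approximation, half for
    the exits from stage \<open>l\<close> on, where \<open>B\<close> departs from
    \<open>D\<close>.\<close>
  obtain D where D: "finite_depth D" "measure coin (symdiff A D) < \<epsilon> / 2"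
    using finite_depth_approx[OF assms(5), of "\<epsilon> / 2"] assms(6) by auto
  obtain L where L: "\<And>x y. y \<in> cyl x L \<Longrightarrow> y \<in> D \<longleftrightarrow> x \<in> D"
    using D(1) unfolding finite_depth_def by blast
  obtain l where l: "(1/2::real) ^ l < \<epsilon> / 2"
    using real_arch_pow_inv[of "\<epsilon> / 2" "1/2"] assms(6) by auto
  interpret density_coding X D a L l
    by unfold_locales (fact a L \<open>X \<noteq> {}\<close> \<open>X \<noteq> UNIV\<close>)+
  have "measure coin (symdiff A B) < \<epsilon>"
    using measure_symdiff_triangle[OF assms(5) finite_depth_sets[OF D(1)] B_sets] D(2) l symdiff_B_D
    by linarith
  moreover have "Phi B \<in> d" using X_le_Phi Phi_le_X by (simp add: d wadge_eq_def)
  \<comment> \<open>\<open>B\<close> is the open witness and \<open>B \<union> spine\<close> the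
    closed one; the null spine does not affect densities.\<close>
  moreover have "Phi B = Phi (B \<union> spine)" using Phi_Un_null[OF B_sets spine_null] by simp
  ultimately show ?thesis using B_sets B_open B_spine_closed by blast
qed

end
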